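(* Let $D\ge1$ and $|{\bm{V}}|\ge2$ be integers. Let ${\bm{C}}\in\mathbb{R}^{D\times|{\bm{V}}|}$ have spectral norm $\|{\bm{C}}\|_2=\sigma_C$ and let ${\bm{h}}\in\mathbb{R}^D$ satisfy $|h_i|\le\sigma_h$ for all $i$. Set $\rho=\sigma_C\sigma_h$, ${\bm{u}}={\bm{C}}^\top{\bm{h}}\in\mathbb{R}^{|{\bm{V}}|}$, and $$\gamma=\exp\!\Big(-\rho\sqrt{\tfrac{D|{\bm{V}}|}{|{\bm{V}}|-1}}\Big).$$ Let $\mathcal{H}_{{\bm{u}}}=-\sum_{i=1}^{|{\bm{V}}|}p_i\log p_i$ be the entropy of ${\bm{p}}=\mathrm{softmax}({\bm{u}})$, $p_i=e^{u_i}/\sum_j e^{u_j}$. Then $$\mathcal{H}_{{\bm{u}}}\;\ge\;\log\big(1+(|{\bm{V}}|-1)\gamma\big)+\frac{\rho\,\gamma\sqrt{D|{\bm{V}}|(|{\bm{V}}|-1)}}{1+(|{\bm{V}}|-1)\gamma}.$$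
   Context: $\|\cdot\|_2$ is the spectral norm of a matrix; logarithms are natural. ${\bm{C}}$ plays the role of the language-model head (classifier) with hidden size $D$ and vocabulary size $|{\bm{V}}|$, ${\bm{h}}$ the final hidden state, and ${\bm{u}}$ the resulting logits. *)

theory Defs
  imports "HOL-Analysis.Analysis"
begin

definition spectral_norm :: "real^'n^'m \<Rightarrow> real" where
  "spectral_norm A = onorm (\<lambda>x. A *v x)"

definition softmax :: "real^'v \<Rightarrow> real^'v" where
  "softmax u = (\<chi> i. exp (u $ i) / (\<Sum>j\<in>UNIV. exp (u $ j)))"

definition entropy :: "real^'v \<Rightarrow> real" where
  "entropy p = - (\<Sum>i\<in>UNIV. p $ i * ln (p $ i))"

end

theory Submission
  imports Defs
begin

text \<open>
  Since \<open>\<parallel>C\<^sup>T h\<parallel> \<le> R\<close> with \<open>R = \<rho> \<surd>D\<close>, it suffices to minimise \<open>u \<mapsto> H (softmax u)\<close> over the ball of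
  radius \<open>R\<close>. At a nonconstant minimiser the Lagrange condition reads
  \<open>exp (u i) * (u i - m) = c * u i\<close> with \<open>c > 0\<close> and \<open>m = \<Sum>p i * u i \<ge> 0\<close>. Hence each \<open>u i\<close> is
  negative or larger than \<open>m\<close>, and \<open>x \<mapsto> exp x * (1 - m / x)\<close> is injective on each of the two ranges,
  so that \<open>u\<close> takes just two values. If the larger value is taken on a fraction \<open>q\<close> of the coordinates and
  the gap between the values is \<open>t\<close>, the entropy is \<open>ln n + G q t\<close> with
  \<open>G q t = ln E - t * q * exp t / E\<close> and \<open>E = q * exp t + 1 - q\<close>, while the norm of \<open>u\<close> fixes
  \<open>r = t * sqrt (q * (1 - q))\<close>. For fixed \<open>r\<close> this is increasing in \<open>q\<close>: the sign condition
  on the derivative is affine in \<open>q\<close>, and at \<open>q = 0\<close> and \<open>q = 1\<close> it is the second-order Taylor bound for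
  \<open>exp (- t)\<close> and \<open>exp t\<close>. So the minimum is at \<open>q = 1 / n\<close>.
\<close>

section \<open>Entropy deficit of two-level vectors\<close>

text \<open>This is \<open>G\<close> of the overview: minus the Kullback-Leibler divergence from
  uniform, when a fraction \<open>q\<close> of the coordinates has logits larger by
  \<open>t\<close>. Taking \<open>q\<close> real allows differentiation in it.\<close>

definition two_level_entropy :: "real \<Rightarrow> real \<Rightarrow> real" where
  "two_level_entropy q t =
     ln (q * exp t + (1 - q)) - t * q * exp t / (q * exp t + (1 - q))"

lemma two_level_denom_pos:
  fixes q t :: real
  assumes "0 < q" "q < 1"
  shows "0 < q * exp t + (1 - q)"
  using assms by (simp add: add_pos_pos)

lemma two_level_entropy_zero [simp]: "two_level_entropy q 0 = 0"
  by (simp add: two_level_entropy_def)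

text \<open>The derivative in the gap is \<open>- x\<close> times the variance
  \<open>q * exp x * (1 - q) / (E * E)\<close> of the indicator of the upper level.\<close>

lemma two_level_entropy_antimono:
  assumes q: "0 < q" "q < 1" and t: "0 \<le> s" "s \<le> t"
  shows "two_level_entropy q t \<le> two_level_entropy q s"
proof (rule DERIV_nonpos_imp_nonincreasing[OF t(2)])
  fix x assume x: "s \<le> x" "x \<le> t"
  define E where "E = q * exp x + (1 - q)"
  have E: "E > 0" using two_level_denom_pos[OF q] by (simp add: E_def)
  have "(two_level_entropy q has_real_derivative
          (q * exp x / E - ((q * exp x + x * q * exp x) * E - x * q * exp x * (q * exp x)) / (E * E))) (at x)"
    unfolding two_level_entropy_def[abs_def]
    using E by (auto intro!: derivative_eq_intros simp: E_def algebra_simps)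
  moreover have "q * exp x / E - ((q * exp x + x * q * exp x) * E - x * q * exp x * (q * exp x)) / (E * E)
      = - (x * (q * exp x * (1 - q))) / (E * E)"
  proof -
    have "q * exp x / E = q * exp x * E / (E * E)" using E by simp
    moreover have "q * exp x * E - ((q * exp x + x * q * exp x) * E - x * q * exp x * (q * exp x))
        = - (x * (q * exp x * (1 - q)))"
      unfolding E_def by algebra
    ultimately show ?thesis by (metis diff_divide_distrib)
  qed
  moreover have "- (x * (q * exp x * (1 - q))) / (E * E) \<le> 0"
    using q t x E by (simp add: divide_nonpos_pos)
  ultimately show "\<exists>y. (two_level_entropy q has_real_derivative y) (at x) \<and> y \<le> 0"
    by auto
qed

lemma exp_minus_le_quadratic:
  fixes t :: real
  assumes "0 \<le> t"
  shows "exp (- t) \<le> 1 - t + t\<^sup>2 / 2"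
proof -
  let ?f = "\<lambda>t::real. 1 - t + t\<^sup>2 / 2 - exp (- t)"
  have "?f 0 \<le> ?f t"
  proof (rule DERIV_nonneg_imp_nondecreasing[OF assms])
    fix x :: real
    have "(?f has_real_derivative (- 1 + x + exp (- x))) (at x)"
      by (auto intro!: derivative_eq_intros)
    moreover have "- 1 + x + exp (- x) \<ge> 0" using exp_ge_add_one_self[of "- x"] by simp
    ultimately show "\<exists>y. (?f has_real_derivative y) (at x) \<and> 0 \<le> y" by blast
  qed
  then show ?thesis by simp
qed

text \<open>The expression is the numerator of the derivative in
  \<open>two_level_entropy_mono_fraction\<close>. Being affine in \<open>q\<close>, it is the convex
  combination of its values at the endpoints, which are nonnegative by \<open>b\<close>
  (\<open>q = 0\<close>) and \<open>a\<close> (\<open>q = 1\<close>).\<close>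

lemma two_level_derivative_sign:
  fixes q t :: real
  assumes q: "0 \<le> q" "q \<le> 1" and t: "0 \<le> t"
  shows "0 \<le> (exp t - 1) * (q * exp t + (1 - q)) - t * exp t + t\<^sup>2 * (1 - 2 * q) / 2 * exp t"
proof -
  have a: "0 \<le> exp t - 1 - t - t\<^sup>2 / 2" using exp_lower_Taylor_quadratic[OF t] by simp
  have "0 \<le> exp t * (1 - t + t\<^sup>2 / 2 - exp (- t))" using exp_minus_le_quadratic[OF t] by simp
  also have "\<dots> = exp t - t * exp t + t\<^sup>2 / 2 * exp t - 1"
    by (simp add: algebra_simps exp_minus)
  finally have b: "0 \<le> exp t - 1 - t * exp t + t\<^sup>2 / 2 * exp t" by simp
  have "(exp t - 1) * (q * exp t + (1 - q)) - t * exp t + t\<^sup>2 * (1 - 2 * q) / 2 * exp t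
     = q * (exp t * (exp t - 1 - t - t\<^sup>2 / 2)) + (1 - q) * (exp t - 1 - t * exp t + t\<^sup>2 / 2 * exp t)"
    by (simp add: field_simps power2_eq_square)
  then show ?thesis using a b q by simp
qed

lemma two_level_entropy_mono_fraction:
  assumes q: "0 < q" "q \<le> q'" "q' < 1" and r: "0 \<le> r"
  shows "two_level_entropy q (r / sqrt (q * (1 - q))) \<le> two_level_entropy q' (r / sqrt (q' * (1 - q')))"
proof (rule DERIV_nonneg_imp_nondecreasing[OF q(2)])
  fix x assume x: "q \<le> x" "x \<le> q'"
  have x01: "0 < x" "x < 1" using x q by auto
  define w where "w = x * (1 - x)"
  have w: "w > 0" using x01 by (simp add: w_def)
  define t where "t = r / sqrt w"
  have t: "t \<ge> 0" using r w by (simp add: t_def)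
  \<comment> \<open>Logarithmic differentiation of \<open>t\<^sup>2 * w = r\<^sup>2\<close> gives
    this slope of the gap.\<close>
  define t' where "t' = - t * (1 - 2 * x) / (2 * w)"
  let ?T = "\<lambda>q. r / sqrt (q * (1 - q))"
  have "(?T has_real_derivative - (r * ((1 - 2 * x) * (inverse (sqrt w) / 2))) / (sqrt w * sqrt w)) (at x)"
    using w unfolding w_def
    by (auto intro!: derivative_eq_intros simp: algebra_simps)
  moreover have "- (r * ((1 - 2 * x) * (inverse (sqrt w) / 2))) / (sqrt w * sqrt w) = t'"
    using w by (simp add: t'_def t_def field_simps)
  ultimately have dT: "(?T has_real_derivative t') (at x)" by simp
  have Tx: "?T x = t" by (simp add: t_def w_def)
  define E where "E = x * exp t + (1 - x)"
  have E: "E > 0" using two_level_denom_pos[OF x01] by (simp add: E_def)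
  define E' where "E' = exp t + x * (exp t * t') - 1"
  have dexp: "((\<lambda>q. exp (?T q)) has_real_derivative exp t * t') (at x)"
    using DERIV_chain2[OF DERIV_exp dT] Tx by simp
  have dE: "((\<lambda>q. q * exp (?T q) + (1 - q)) has_real_derivative E') (at x)"
    by (rule derivative_eq_intros dexp refl)+ (simp add: E'_def Tx algebra_simps t_def w_def)
  have Ex: "x * exp (?T x) + (1 - x) = E" by (simp add: E_def Tx)
  have dN: "((\<lambda>q. ?T q * q * exp (?T q)) has_real_derivative
       (t' * x * exp t + t * exp t + t * x * (exp t * t'))) (at x)"
    by (rule derivative_eq_intros dexp dT refl)+ (simp add: Tx algebra_simps t_def w_def)
  have dln: "((\<lambda>q. ln (q * exp (?T q) + (1 - q))) has_real_derivative E' / E) (at x)"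
    using DERIV_chain2[OF DERIV_ln_divide dE] E Ex by simp
  have dquot: "((\<lambda>q. ?T q * q * exp (?T q) / (q * exp (?T q) + (1 - q))) has_real_derivative
       ((t' * x * exp t + t * exp t + t * x * (exp t * t')) * E - t * x * exp t * E') / (E * E)) (at x)"
    using DERIV_divide[OF dN dE] E Ex Tx by simp
  have "((\<lambda>q. two_level_entropy q (?T q)) has_real_derivative
     (E' / E - ((t' * x * exp t + t * exp t + t * x * (exp t * t')) * E - t * x * exp t * E') / (E * E))) (at x)"
    unfolding two_level_entropy_def by (rule DERIV_diff[OF dln dquot])
  \<comment> \<open>All terms in \<open>t'\<close> collapse to
    \<open>- t * exp t * (t' * w)\<close>, and \<open>t' * w\<close> no longer contains
    \<open>w\<close>.\<close>
  moreover have "E' / E - ((t' * x * exp t + t * exp t + t * x * (exp t * t')) * E - t * x * exp t * E') / (E * E)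
     = ((exp t - 1) * E - t * exp t + t\<^sup>2 * (1 - 2 * x) / 2 * exp t) / (E * E)"
  proof -
    have "E' / E = E' * E / (E * E)" using E by simp
    moreover have "E' * E - ((t' * x * exp t + t * exp t + t * x * (exp t * t')) * E - t * x * exp t * E')
       = (exp t - 1) * E - t * exp t - t * exp t * (t' * w)"
      unfolding E_def E'_def w_def by algebra
    moreover have "t' * w = - t * (1 - 2 * x) / 2" using w by (simp add: t'_def)
    moreover have "- (t * exp t * (- t * (1 - 2 * x) / 2)) = t\<^sup>2 * (1 - 2 * x) / 2 * exp t"
      by (simp add: power2_eq_square)
    ultimately show ?thesis by (metis diff_divide_distrib diff_conv_add_uminus)
  qed
  moreover have "((exp t - 1) * E - t * exp t + t\<^sup>2 * (1 - 2 * x) / 2 * exp t) / (E * E) \<ge> 0"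
    using two_level_derivative_sign[of x t] x01 t E by (simp add: E_def)
  ultimately show "\<exists>y. ((\<lambda>q. two_level_entropy q (?T q)) has_real_derivative y) (at x) \<and> 0 \<le> y"
    by auto
qed

section \<open>Softmax entropy and its gradient\<close>

lemma sum_exp_pos:
  fixes u :: "real^'v"
  shows "0 < (\<Sum>j\<in>UNIV. exp (u $ j))"
  by (rule sum_pos) auto

text \<open>Since \<open>ln (p i) = u i - ln Z\<close>, the entropy is the log-partition function
  minus the mean logit, a form that is easy to differentiate.\<close>

lemma entropy_softmax:
  fixes u :: "real^'v"
  shows "entropy (softmax u) = ln (\<Sum>j\<in>UNIV. exp (u $ j))
     - (\<Sum>i\<in>UNIV. u $ i * exp (u $ i)) / (\<Sum>j\<in>UNIV. exp (u $ j))"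
proof -
  define Z where "Z = (\<Sum>j\<in>UNIV. exp (u $ j))"
  have Z: "Z > 0" using sum_exp_pos by (simp add: Z_def)
  have "entropy (softmax u) = - (\<Sum>i\<in>UNIV. exp (u $ i) / Z * (u $ i - ln Z))"
    using Z unfolding entropy_def softmax_def Z_def[symmetric] by (simp add: ln_div)
  also have "\<dots> = - (\<Sum>i\<in>UNIV. u $ i * exp (u $ i) / Z - ln Z / Z * exp (u $ i))"
    by (simp add: algebra_simps diff_divide_distrib)
  also have "\<dots> = - ((\<Sum>i\<in>UNIV. u $ i * exp (u $ i)) / Z - ln Z / Z * Z)"
    by (simp add: sum_subtractf sum_divide_distrib sum_distrib_left Z_def)
  finally show ?thesis using Z by (simp add: Z_def)
qed

lemma continuous_on_entropy_softmax:
  "continuous_on S (\<lambda>u::real^'v. entropy (softmax u))"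
  unfolding entropy_softmax
  using less_imp_neq[OF sum_exp_pos, symmetric]
  by (intro continuous_intros) (auto simp: sum_exp_pos)

definition entropy_grad :: "real^'v \<Rightarrow> real^'v" where
  "entropy_grad u =
     (let p = softmax u in \<chi> i. - (p $ i * (u $ i - (\<Sum>j\<in>UNIV. p $ j * u $ j))))"

lemma entropy_softmax_directional_derivative:
  fixes u v :: "real^'v"
  shows "((\<lambda>s. entropy (softmax (u + s *\<^sub>R v))) has_real_derivative (entropy_grad u \<bullet> v)) (at 0)"
proof -
  define Z where "Z = (\<Sum>j\<in>UNIV. exp (u $ j))"
  define N where "N = (\<Sum>i\<in>UNIV. u $ i * exp (u $ i))"
  define Z' where "Z' = (\<Sum>i\<in>UNIV. v $ i * exp (u $ i))"
  define M where "M = (\<Sum>i\<in>UNIV. u $ i * v $ i * exp (u $ i))"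
  have Z: "Z > 0" using sum_exp_pos by (simp add: Z_def)
  have dZ: "((\<lambda>s. \<Sum>j\<in>UNIV. exp (u $ j + s * v $ j)) has_real_derivative Z') (at 0)"
    unfolding Z'_def by (auto intro!: derivative_eq_intros sum.cong)
  have dN: "((\<lambda>s. \<Sum>j\<in>UNIV. (u $ j + s * v $ j) * exp (u $ j + s * v $ j)) has_real_derivative (Z' + M)) (at 0)"
    unfolding Z'_def M_def sum.distrib[symmetric]
    by (auto intro!: derivative_eq_intros sum.cong simp: algebra_simps)
  have "((\<lambda>s. entropy (softmax (u + s *\<^sub>R v))) has_real_derivative
       (Z' / Z - ((Z' + M) * Z - N * Z') / (Z * Z))) (at 0)"
    unfolding entropy_softmax
    using DERIV_diff[OF DERIV_chain2[OF DERIV_ln_divide dZ] DERIV_divide[OF dN dZ]] Z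
    by (simp add: Z_def N_def)
  moreover have "entropy_grad u \<bullet> v = Z' / Z - ((Z' + M) * Z - N * Z') / (Z * Z)"
  proof -
    have m: "(\<Sum>j\<in>UNIV. softmax u $ j * u $ j) = N / Z"
      unfolding N_def sum_divide_distrib softmax_def Z_def[symmetric] by (simp add: mult.commute)
    have "entropy_grad u \<bullet> v = (\<Sum>i\<in>UNIV. - (exp (u $ i) / Z * (u $ i - N / Z)) * v $ i)"
      unfolding entropy_grad_def Let_def m inner_vec_def
      by (simp add: softmax_def Z_def[symmetric])
    also have "\<dots> = (\<Sum>i\<in>UNIV. N / Z / Z * (v $ i * exp (u $ i)) - (u $ i * v $ i * exp (u $ i)) / Z)"
      using Z by (intro sum.cong) (auto simp: field_simps)
    also have "\<dots> = N / Z / Z * Z' - M / Z"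
      by (simp only: sum_subtractf sum_distrib_left[symmetric] sum_divide_distrib[symmetric] Z'_def M_def)
    finally show ?thesis using Z by (simp add: field_simps)
  qed
  ultimately show ?thesis by simp
qed

section \<open>First-order optimality on a ball\<close>

text \<open>The component \<open>w\<close> of \<open>g\<close> orthogonal to \<open>u\<close> must
  vanish: otherwise \<open>- w\<close>, tilted slightly inward to make its product with
  \<open>u\<close> strictly negative, violates the hypothesis.\<close>

lemma ball_normal_cone:
  fixes g u :: "'a::real_inner"
  assumes u: "u \<noteq> 0" and g: "\<And>v. v \<bullet> u < 0 \<Longrightarrow> 0 \<le> g \<bullet> v"
  obtains l where "0 \<le> l" "g = - l *\<^sub>R u"
proof -
  define l where "l = - (g \<bullet> u) / (u \<bullet> u)"
  have uu: "u \<bullet> u > 0" using u by simp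
  have gu: "g \<bullet> u \<le> 0" using g[of "- u"] uu by simp
  define w where "w = g + l *\<^sub>R u"
  have wu: "w \<bullet> u = 0" using uu by (simp add: w_def l_def inner_add_left inner_diff_left)
  have gw: "g \<bullet> w = w \<bullet> w"
    using wu by (metis add.right_neutral inner_add_left inner_commute inner_scaleR_left mult_zero_right w_def)
  have "w \<bullet> w \<le> 0"
  proof (rule ccontr)
    assume "\<not> w \<bullet> w \<le> 0"
    then have ww: "w \<bullet> w > 0" by linarith
    \<comment> \<open>Chosen so that the tilt costs at most half of \<open>w \<bullet> w\<close>;
      the summand 1 keeps the denominator positive when \<open>g \<bullet> u = 0\<close>.\<close>
    define e where "e = (w \<bullet> w) / (2 * (1 - g \<bullet> u))"
    have e: "e > 0" using ww gu by (simp add: e_def)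
    have "(- w - e *\<^sub>R u) \<bullet> u < 0" using wu e uu by (simp add: inner_diff_left)
    then have "0 \<le> g \<bullet> (- w - e *\<^sub>R u)" by (rule g)
    then have "w \<bullet> w \<le> e * (- (g \<bullet> u))" using gw by (simp add: inner_diff_right)
    also have "\<dots> \<le> e * (1 - g \<bullet> u)" using e by (intro mult_left_mono) auto
    also have "\<dots> = (w \<bullet> w) / 2" using gu by (simp add: e_def field_simps)
    finally show False using ww by simp
  qed
  then have "w = 0" by (simp add: inner_gt_zero_iff flip: not_less)
  then have "g = - l *\<^sub>R u" by (simp add: w_def add_eq_0_iff2)
  moreover have "l \<ge> 0" using gu uu by (simp add: l_def divide_nonpos_pos)
  ultimately show ?thesis using that by blast
qed

text \<open>A direction with \<open>v \<bullet> u < 0\<close> does not increase the norm for small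
  steps, so it stays in the ball whether \<open>u\<close> is interior or on the boundary.\<close>

lemma ball_minimizer_derivative_nonneg:
  fixes u v :: "'a::real_inner"
  assumes u: "norm u \<le> R" and min: "\<And>w. norm w \<le> R \<Longrightarrow> f u \<le> f w"
    and d: "((\<lambda>s. f (u + s *\<^sub>R v)) has_real_derivative D) (at 0)" and vu: "v \<bullet> u < 0"
  shows "0 \<le> D"
proof (rule ccontr)
  assume "\<not> 0 \<le> D"
  then obtain e where e: "e > 0" "\<And>s. 0 < s \<Longrightarrow> s < e \<Longrightarrow> f (u + s *\<^sub>R v) < f u"
    using DERIV_neg_dec_right[OF d] by auto
  have vv: "v \<bullet> v > 0" using vu by auto
  \<comment> \<open>The second bound is the step at which the norm is back at
    \<open>norm u\<close>.\<close>
  define s where "s = min (e / 2) (- 2 * (v \<bullet> u) / (v \<bullet> v))"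
  have s: "0 < s" "s < e" "s * (v \<bullet> v) \<le> - 2 * (v \<bullet> u)"
    using e vu vv by (auto simp: s_def min_def field_simps)
  have "(norm (u + s *\<^sub>R v))\<^sup>2 = (norm u)\<^sup>2 + s * (2 * (v \<bullet> u) + s * (v \<bullet> v))"
    by (simp add: power2_norm_eq_inner inner_add_left inner_add_right inner_commute algebra_simps)
  also have "\<dots> \<le> (norm u)\<^sup>2" using s by (simp add: mult_nonneg_nonpos)
  finally have "norm (u + s *\<^sub>R v) \<le> R"
    using u power2_le_imp_le[of "norm (u + s *\<^sub>R v)" "norm u"] by simp
  then show False using min e(2)[OF s(1,2)] by (meson not_le)
qed

section \<open>Critical points take two values\<close>

text \<open>On either range both factors are positive and strictly increasing.\<close>

lemma exp_times_one_minus_divide_inj: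
  fixes x y m :: real
  assumes m: "0 < m" and s: "x < 0 \<and> y < 0 \<or> m < x \<and> m < y"
    and eq: "exp x * (1 - m / x) = exp y * (1 - m / y)"
  shows "x = y"
proof -
  have *: "exp x * (1 - m / x) < exp y * (1 - m / y)"
    if "x < y" "x < 0 \<and> y < 0 \<or> m < x \<and> m < y" for x y
  proof (rule mult_strict_mono)
    show "1 - m / x < 1 - m / y" using that m by (auto simp: field_simps)
    show "0 \<le> 1 - m / x" using that m by (auto simp: field_simps)
  qed (use that in auto)
  show ?thesis using *[of x y] *[of y x] eq s by (cases x y rule: linorder_cases) auto
qed

lemma critical_two_valued:
  fixes u :: "real^'v"
  assumes c: "0 < c" and crit: "\<And>i. exp (u $ i) * (u $ i - m) = c * u $ i"
    and sum0: "(\<Sum>i\<in>UNIV. u $ i) = 0"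
  obtains a b where "\<And>i. u $ i = a \<or> u $ i = b"
proof -
  have "u $ i - m = c * (u $ i * exp (- (u $ i)))" for i
    using crit[of i] by (simp add: exp_minus field_simps)
  \<comment> \<open>This holds for either sign of \<open>u $ i\<close>; summing over
    \<open>i\<close> and using \<open>sum0\<close> then yields \<open>0 \<le> m\<close>.\<close>
  also have "c * (u $ i * exp (- (u $ i))) \<le> c * u $ i" for i
  proof -
    have "u $ i * exp (- (u $ i)) \<le> u $ i"
    proof (cases "u $ i \<ge> 0")
      case True then show ?thesis by (simp add: mult_left_le)
    next
      case False
      then show ?thesis using mult_left_mono_neg[of 1 "exp (- (u $ i))" "u $ i"] by simp
    qed
    then show ?thesis using c by simp
  qed
  finally have "(\<Sum>i\<in>UNIV. u $ i - m) \<le> (\<Sum>i\<in>UNIV. c * u $ i)" by (intro sum_mono)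
  then have "0 \<le> m"
    using sum0 by (simp add: sum_subtractf sum_distrib_left[symmetric] zero_le_mult_iff)
  show ?thesis
  proof (cases "m = 0")
    case True
    then have "u $ i = 0 \<or> u $ i = ln c" for i using crit[of i] by auto
    then show ?thesis using that by blast
  next
    case False
    then have m: "m > 0" using \<open>0 \<le> m\<close> by simp
    \<comment> \<open>On the interval from 0 to \<open>m\<close> the two sides of
      \<open>crit\<close> have opposite signs, so both vanish; but \<open>u $ i = 0\<close> would
      force \<open>m = 0\<close>.\<close>
    have sgn: "u $ i < 0 \<or> m < u $ i" for i
    proof (rule ccontr)
      assume "\<not> ?thesis"
      then have i: "0 \<le> u $ i" "u $ i \<le> m" by auto
      then have "exp (u $ i) * (u $ i - m) \<le> 0" by (simp add: mult_nonneg_nonpos)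
      then have "u $ i = 0" using crit[of i] c i by (simp add: mult_le_0_iff)
      then show False using crit[of i] m by simp
    qed
    have phi: "exp (u $ i) * (1 - m / u $ i) = c" for i
    proof -
      have "u $ i \<noteq> 0" using sgn[of i] m by auto
      then show ?thesis using crit[of i] by (simp add: field_simps)
    qed
    have same: "u $ i = u $ j" if "u $ i < 0 \<and> u $ j < 0 \<or> m < u $ i \<and> m < u $ j" for i j
      using exp_times_one_minus_divide_inj[OF m that] phi by simp
    \<comment> \<open>If one of the ranges is empty, its \<open>SOME\<close> is an arbitrary value
      and all coordinates agree with the other one.\<close>
    show ?thesis
      by (rule that[of "u $ (SOME i. m < u $ i)" "u $ (SOME i. u $ i < 0)"])
        (use sgn same someI in metis)
  qed
qed

section \<open>Entropy of two-valued vectors\<close>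

text \<open>Factoring \<open>exp b\<close> out of both sums leaves only the gap: the
  \<open>b\<close> from the logarithm cancels the \<open>b\<close> from the mean logit.\<close>

lemma entropy_softmax_two_valued:
  fixes u :: "real^'v"
  assumes ab: "\<And>i. u $ i = (if i \<in> A then a else b)"
    and A: "A \<noteq> {}" "A \<noteq> UNIV"
  shows "entropy (softmax u) = ln (real CARD('v))
    + two_level_entropy (real (card A) / real CARD('v)) (a - b)"
proof -
  define n where "n = real CARD('v)"
  define k where "k = real (card A)"
  define q where "q = k / n"
  define E where "E = q * exp (a - b) + (1 - q)"
  have n: "n > 0" by (simp add: n_def)
  have k: "0 < k" "k < n"
    using A psubset_card_mono[of UNIV A] by (auto simp: k_def n_def card_gt_0_iff)
  have q: "0 < q" "q < 1" using k n by (auto simp: q_def)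
  have E: "E > 0" using two_level_denom_pos[OF q] by (simp add: E_def)
  have cc: "real (card (- A)) = n - k"
    by (simp add: Compl_eq_Diff_UNIV card_Diff_subset k_def n_def card_mono of_nat_diff)
  have split: "(\<Sum>i\<in>UNIV. f (u $ i)) = k * f a + (n - k) * f b" for f :: "real \<Rightarrow> real"
  proof -
    have "(\<Sum>i\<in>UNIV. f (u $ i)) = (\<Sum>i\<in>UNIV. if i \<in> A then f a else f b)"
      by (intro sum.cong) (auto simp: ab)
    then show ?thesis
      by (simp add: sum.If_cases Compl_eq_Diff_UNIV[symmetric] cc flip: k_def)
  qed
  have kq: "k = n * q" using n by (simp add: q_def)
  have ea: "exp a = exp b * exp (a - b)" by (simp flip: exp_add)
  have Z: "(\<Sum>i\<in>UNIV. exp (u $ i)) = n * exp b * E"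
    unfolding split[of exp] kq ea E_def by (simp add: algebra_simps)
  have N: "(\<Sum>i\<in>UNIV. u $ i * exp (u $ i)) = n * exp b * (b * E + (a - b) * q * exp (a - b))"
    unfolding split[of "\<lambda>x. x * exp x"] kq ea E_def by (simp add: algebra_simps)
  have "entropy (softmax u) = ln (n * exp b * E) - (b * E + (a - b) * q * exp (a - b)) / E"
    unfolding entropy_softmax Z N using n by simp
  also have "\<dots> = ln n + (ln E - (a - b) * q * exp (a - b) / E)"
    using n E by (simp add: ln_mult add_divide_distrib)
  finally show ?thesis
    by (simp add: two_level_entropy_def E_def q_def k_def n_def)
qed

lemma entropy_softmax_const:
  fixes u :: "real^'v"
  assumes "\<And>i. u $ i = a"
  shows "entropy (softmax u) = ln (real CARD('v))"
  unfolding entropy_softmax by (simp add: assms ln_mult)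

text \<open>The norm bound limits the gap. Enlarging the gap at fraction \<open>1 / n\<close> and
  raising the fraction from \<open>1 / n\<close> to \<open>q\<close> at fixed \<open>r\<close>
  connect the two sides.\<close>

lemma two_valued_entropy_ge:
  fixes u :: "real^'v"
  assumes n2: "CARD('v) \<ge> 2" and R: "norm u \<le> R"
    and ab: "\<And>i. u $ i = a \<or> u $ i = b"
  shows "ln (real CARD('v)) + two_level_entropy (1 / real CARD('v)) (R * sqrt (real CARD('v) / (real CARD('v) - 1)))
     \<le> entropy (softmax u)"
  using ab
proof (induction a b rule: linorder_wlog)
  case (sym a b)
  then show ?case by blast
next
  case (le b a)
  define n where "n = real CARD('v)"
  have n: "n \<ge> 2" using n2 by (simp add: n_def)
  have R0: "R \<ge> 0" using R norm_ge_zero order_trans by blast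
  have q1: "0 < 1 / n" "1 / n < 1" using n by auto
  define A where "A = {i. u $ i = a}"
  show ?case
  \<comment> \<open>A constant vector has entropy \<open>ln n\<close>, which corresponds to gap
    0.\<close>
  proof (cases "a = b \<or> A = {} \<or> A = UNIV")
    case True
    then obtain c where "\<And>i. u $ i = c" using le(2) unfolding A_def by blast
    then have "entropy (softmax u) = ln n" unfolding n_def by (rule entropy_softmax_const)
    moreover have "two_level_entropy (1 / n) (R * sqrt (n / (n - 1))) \<le> two_level_entropy (1 / n) 0"
      using R0 n by (intro two_level_entropy_antimono q1) auto
    ultimately show ?thesis by (simp add: n_def)
  next
    case False
    then have A: "A \<noteq> {}" "A \<noteq> UNIV" and t: "a > b" using le(1) by auto
    have uA: "u $ i = (if i \<in> A then a else b)" for i using le(2)[of i] by (auto simp: A_def)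
    define k where "k = real (card A)"
    define q where "q = k / n"
    define t where "t = a - b"
    have k: "1 \<le> k" "k < n"
      using A psubset_card_mono[of UNIV A] by (auto simp: k_def n_def card_gt_0_iff Suc_le_eq)
    have q: "1 / n \<le> q" "0 < q" "q < 1" using k n by (auto simp: q_def field_simps)
    have cc: "real (card (- A)) = n - k"
      by (simp add: Compl_eq_Diff_UNIV card_Diff_subset k_def n_def card_mono of_nat_diff)
    have "(norm u)\<^sup>2 = (\<Sum>i\<in>UNIV. if i \<in> A then a\<^sup>2 else b\<^sup>2)"
      unfolding power2_norm_eq_inner inner_vec_def
      by (intro sum.cong) (auto simp: uA power2_eq_square)
    also have "\<dots> = k * a\<^sup>2 + (n - k) * b\<^sup>2"
      by (simp add: sum.If_cases Compl_eq_Diff_UNIV[symmetric] cc flip: k_def)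
    finally have nu: "(norm u)\<^sup>2 = k * a\<^sup>2 + (n - k) * b\<^sup>2" .
    \<comment> \<open>The decomposition into spread and squared coordinate sum; dropping the latter
      bounds the gap.\<close>
    have "n * (k * a\<^sup>2 + (n - k) * b\<^sup>2) = k * (n - k) * t\<^sup>2 + (k * a + (n - k) * b)\<^sup>2"
      unfolding t_def by algebra
    then have "k * (n - k) * t\<^sup>2 \<le> n * (norm u)\<^sup>2" by (simp add: nu)
    also have "\<dots> \<le> n * R\<^sup>2" using R n by (intro mult_left_mono power_mono) auto
    finally have kt: "k * (n - k) * t\<^sup>2 \<le> n * R\<^sup>2" .
    \<comment> \<open>The standard deviation of the coordinates of \<open>u\<close>, kept fixed
      while the fraction moves.\<close>
    define r where "r = t * sqrt (q * (1 - q))"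
    have r0: "r \<ge> 0" using t q \<open>a > b\<close> by (simp add: r_def t_def)
    have "q * (1 - q) > 0" using q by simp
    then have tr: "r / sqrt (q * (1 - q)) = t" by (auto simp: r_def)
    have "r / sqrt (1 / n * (1 - 1 / n)) \<le> R * sqrt (n / (n - 1))"
    proof (rule power2_le_imp_le)
      have s: "1 / n * (1 - 1 / n) = (n - 1) / n\<^sup>2"
        using n by (simp add: field_simps power2_eq_square)
      have r2: "r\<^sup>2 = k * (n - k) * t\<^sup>2 / n\<^sup>2"
        using n q by (simp add: r_def power_mult_distrib q_def field_simps power2_eq_square)
      have "(r / sqrt (1 / n * (1 - 1 / n)))\<^sup>2 = r\<^sup>2 / ((n - 1) / n\<^sup>2)"
        unfolding s using n by (simp add: power_divide)
      also have "\<dots> = k * (n - k) * t\<^sup>2 / (n - 1)" using n by (simp add: r2)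
      also have "\<dots> \<le> n * R\<^sup>2 / (n - 1)" using kt n by (intro divide_right_mono) auto
      also have "\<dots> = (R * sqrt (n / (n - 1)))\<^sup>2" using n by (simp add: power_mult_distrib)
      finally show "(r / sqrt (1 / n * (1 - 1 / n)))\<^sup>2 \<le> (R * sqrt (n / (n - 1)))\<^sup>2" .
    qed (use R0 n in auto)
    then have "two_level_entropy (1 / n) (R * sqrt (n / (n - 1)))
        \<le> two_level_entropy (1 / n) (r / sqrt (1 / n * (1 - 1 / n)))"
      using r0 n by (intro two_level_entropy_antimono q1) auto
    also have "\<dots> \<le> two_level_entropy q (r / sqrt (q * (1 - q)))"
      by (rule two_level_entropy_mono_fraction) (use q1 q r0 in auto)
    also have "\<dots> = two_level_entropy q t" by (simp only: tr)
    finally show ?thesis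
      using entropy_softmax_two_valued[OF uA A] by (simp add: n_def q_def k_def t_def)
  qed
qed

section \<open>Minimisation over the ball\<close>

text \<open>The gradient is \<open>- l\<close> times \<open>u\<close> with \<open>l \<ge> 0\<close>.
  For \<open>l = 0\<close> all coordinates equal the mean logit; for \<open>l > 0\<close>
  multiplication by \<open>Z\<close> gives the equation of \<open>critical_two_valued\<close> with
  \<open>c = l * Z\<close>.\<close>

lemma entropy_minimizer_two_valued:
  fixes u :: "real^'v"
  assumes u: "norm u \<le> R"
    and min: "\<And>w::real^'v. norm w \<le> R \<Longrightarrow> entropy (softmax u) \<le> entropy (softmax w)"
  obtains a b where "\<And>i. u $ i = a \<or> u $ i = b"
proof (cases "u = 0")
  case True
  then show ?thesis using that[of 0 0] by simp
next
  case False
  obtain l where l: "0 \<le> l" "entropy_grad u = - l *\<^sub>R u"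
    using ball_normal_cone[OF False, of "entropy_grad u"]
      ball_minimizer_derivative_nonneg[where f = "\<lambda>u. entropy (softmax u)",
        OF u min entropy_softmax_directional_derivative]
    by blast
  define Z where "Z = (\<Sum>j\<in>UNIV. exp (u $ j))"
  have Z: "Z > 0" using sum_exp_pos by (simp add: Z_def)
  define m where "m = (\<Sum>j\<in>UNIV. softmax u $ j * u $ j)"
  have p: "softmax u $ i = exp (u $ i) / Z" for i by (simp add: softmax_def Z_def)
  have "entropy_grad u $ i = - (softmax u $ i * (u $ i - m))" for i
    by (simp add: entropy_grad_def m_def Let_def)
  then have crit: "softmax u $ i * (u $ i - m) = l * u $ i" for i
    using l(2) by (metis neg_equal_iff_equal scaleR_minus_left vector_scaleR_component
        real_scaleR_def)
  have psum: "(\<Sum>i\<in>UNIV. softmax u $ i) = 1"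
    using Z by (simp add: p sum_divide_distrib[symmetric] flip: Z_def)
  show ?thesis
  proof (cases "l = 0")
    case True
    then have "u $ i = m" for i using crit[of i] Z by (simp add: p)
    then show ?thesis using that by blast
  next
    case False
    then have l0: "l > 0" using l by simp
    \<comment> \<open>The entries of the gradient sum to zero, hence so do those of
      \<open>u\<close>.\<close>
    have "l * (\<Sum>i\<in>UNIV. u $ i) = (\<Sum>i\<in>UNIV. softmax u $ i * u $ i - softmax u $ i * m)"
      by (simp add: sum_distrib_left crit[symmetric] right_diff_distrib)
    also have "\<dots> = 0"
      by (simp add: sum_subtractf sum_distrib_right[symmetric] psum m_def)
    finally have "(\<Sum>i\<in>UNIV. u $ i) = 0" using l0 by simp
    moreover have "exp (u $ i) * (u $ i - m) = l * Z * u $ i" for i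
      using crit[of i] Z by (simp add: p field_simps)
    ultimately show ?thesis using critical_two_valued[of "l * Z" u m] l0 Z that by auto
  qed
qed

lemma entropy_softmax_ge:
  fixes u :: "real^'v"
  assumes n2: "CARD('v) \<ge> 2" and R: "norm u \<le> R"
  shows "ln (real CARD('v)) + two_level_entropy (1 / real CARD('v)) (R * sqrt (real CARD('v) / (real CARD('v) - 1)))
     \<le> entropy (softmax u)"
proof -
  have "\<exists>x\<in>cball (0::real^'v) R. \<forall>y\<in>cball (0::real^'v) R. entropy (softmax x) \<le> entropy (softmax y)"
  proof (rule continuous_attains_inf)
    show "cball (0::real^'v) R \<noteq> {}"
      using R norm_ge_zero[of u] by (simp del: norm_ge_zero)
    show "continuous_on (cball (0::real^'v) R) (\<lambda>x. entropy (softmax x))"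
      by (rule continuous_on_entropy_softmax)
    show "compact (cball (0::real^'v) R)" by (rule compact_cball)
  qed
  then obtain x :: "real^'v" where x: "norm x \<le> R"
    "\<And>w::real^'v. norm w \<le> R \<Longrightarrow> entropy (softmax x) \<le> entropy (softmax w)"
    by auto
  obtain a b where "\<And>i. x $ i = a \<or> x $ i = b"
    using entropy_minimizer_two_valued[OF x] by blast
  then show ?thesis
    using two_valued_entropy_ge[OF n2 x(1)] x(2)[OF R] by (meson order_trans)
qed

section \<open>Norm of the logits and the final bound\<close>

text \<open>With \<open>y = transpose C *v h\<close>, moving \<open>C\<close> across the inner
  product gives \<open>y \<bullet> y = h \<bullet> (C *v y)\<close>; Cauchy-Schwarz and cancelling
  one factor \<open>norm y\<close> finish the argument.\<close>

lemma norm_transpose_mult_le: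
  fixes C :: "real^'v^'d"
  shows "norm (transpose C *v h) \<le> spectral_norm C * norm h"
proof (cases "transpose C *v h = 0")
  case True
  then show ?thesis
    by (simp add: spectral_norm_def onorm_pos_le matrix_vector_mul_bounded_linear)
next
  case False
  let ?y = "transpose C *v h"
  have "norm ?y * norm ?y = h \<bullet> (C *v ?y)"
    by (metis dot_lmul_matrix power2_eq_square power2_norm_eq_inner transpose_matrix_vector)
  also have "\<dots> \<le> norm h * norm (C *v ?y)" by (rule norm_cauchy_schwarz)
  also have "\<dots> \<le> norm h * (spectral_norm C * norm ?y)"
    unfolding spectral_norm_def
    by (intro mult_left_mono onorm matrix_vector_mul_bounded_linear) auto
  finally have "norm ?y * norm ?y \<le> (spectral_norm C * norm h) * norm ?y" by (simp add: mult_ac)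
  then show ?thesis using False by (simp only: mult_le_cancel_right_pos zero_less_norm_iff not_False_eq_True)
qed

lemma norm_le_sqrt_card:
  fixes h :: "real^'d"
  assumes "\<forall>i. \<bar>h $ i\<bar> \<le> s"
  shows "norm h \<le> s * sqrt (real CARD('d))"
proof -
  have s: "s \<ge> 0" using assms abs_ge_zero order_trans by blast
  have "(\<Sum>i\<in>UNIV. (h $ i)\<^sup>2) \<le> (\<Sum>i\<in>(UNIV::'d set). s\<^sup>2)"
    using assms s by (intro sum_mono) (simp add: abs_le_square_iff[symmetric])
  then have "norm h \<le> sqrt (real CARD('d) * s\<^sup>2)"
    by (simp add: norm_vec_def L2_set_def)
  then show ?thesis using s by (simp add: real_sqrt_mult mult.commute)
qed

theorem theorem4p2:
  fixes C :: "real^'v^'d" and h :: "real^'d" and \<sigma>C \<sigma>h :: real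
  assumes "CARD('v) \<ge> 2"
    and "spectral_norm C = \<sigma>C"
    and "\<forall>i. \<bar>h $ i\<bar> \<le> \<sigma>h"
  shows "let D = real CARD('d); V = real CARD('v); \<rho> = \<sigma>C * \<sigma>h;
             u = transpose C *v h;
             \<gamma> = exp (- \<rho> * sqrt (D * V / (V - 1)))
         in entropy (softmax u) \<ge> ln (1 + (V - 1) * \<gamma>)
              + \<rho> * \<gamma> * sqrt (D * V * (V - 1)) / (1 + (V - 1) * \<gamma>)"
proof -
  define D where "D = real CARD('d)"
  define V where "V = real CARD('v)"
  define \<rho> where "\<rho> = \<sigma>C * \<sigma>h"
  define t where "t = \<rho> * sqrt (D * V / (V - 1))"
  define \<gamma> where "\<gamma> = exp (- t)"
  have V: "V \<ge> 2" using assms(1) by (simp add: V_def)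
  have C0: "\<sigma>C \<ge> 0"
    using assms(2) by (auto simp: spectral_norm_def onorm_pos_le matrix_vector_mul_bounded_linear)
  have "norm (transpose C *v h) \<le> \<sigma>C * norm h" using norm_transpose_mult_le assms(2) by blast
  also have "\<dots> \<le> \<sigma>C * (\<sigma>h * sqrt D)"
    unfolding D_def by (intro mult_left_mono norm_le_sqrt_card assms C0)
  finally have "norm (transpose C *v h) \<le> \<rho> * sqrt D" by (simp add: \<rho>_def)
  from entropy_softmax_ge[OF assms(1) this]
  have "ln V + two_level_entropy (1 / V) (\<rho> * sqrt D * sqrt (V / (V - 1))) \<le> entropy (softmax (transpose C *v h))"
    by (simp add: V_def)
  also have "\<rho> * sqrt D * sqrt (V / (V - 1)) = t"
    by (simp add: t_def real_sqrt_mult[symmetric])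
  also have "ln V + two_level_entropy (1 / V) t
      = ln (1 + (V - 1) * \<gamma>) + \<rho> * \<gamma> * sqrt (D * V * (V - 1)) / (1 + (V - 1) * \<gamma>)"
  proof -
    define S where "S = 1 + (V - 1) * \<gamma>"
    have g: "\<gamma> > 0" "exp t = 1 / \<gamma>" by (simp_all add: \<gamma>_def exp_minus inverse_eq_divide)
    have S: "S > 0" using V g by (simp add: S_def add_pos_nonneg)
    \<comment> \<open>The denominator of \<open>two_level_entropy\<close> at
      \<open>q = 1 / V\<close>, rewritten by \<open>exp t = 1 / \<gamma>\<close>. Its logarithm
      contributes the \<open>t\<close> in \<open>t - t / S\<close>, which is the second term of the
      bound.\<close>
    have E: "1 / V * exp t + (1 - 1 / V) = S / (V * \<gamma>)"
      using V g by (simp add: S_def field_simps)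
    have lnE: "ln (S / (V * \<gamma>)) = ln S - ln V + t"
      using V g S by (simp add: ln_div ln_mult) (simp add: \<gamma>_def)
    \<comment> \<open>Pulling \<open>V - 1\<close> out of the root exhibits \<open>t\<close>, with
      \<open>(V - 1) * \<gamma> = S - 1\<close> as cofactor.\<close>
    have "sqrt (D * V * (V - 1)) = sqrt (D * V / (V - 1) * (V - 1)\<^sup>2)"
      using V by (simp add: power2_eq_square)
    also have "\<dots> = sqrt (D * V / (V - 1)) * (V - 1)"
      using V by (simp only: real_sqrt_mult real_sqrt_abs abs_of_nonneg)
    finally have num: "\<rho> * \<gamma> * sqrt (D * V * (V - 1)) = t * (S - 1)"
      by (simp add: t_def S_def)
    have quot: "t * (1 / V) * exp t / (S / (V * \<gamma>)) = t / S"
      using V g S by simp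
    have "t - t / S = t * (S - 1) / S" using S by (simp add: field_simps)
    then show ?thesis
      unfolding two_level_entropy_def E lnE S_def[symmetric] num quot by linarith
  qed
  finally show ?thesis
    unfolding Let_def D_def[symmetric] V_def[symmetric] \<rho>_def[symmetric]
    by (simp add: \<gamma>_def t_def)
qed

end
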